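(* Let $(X,d)$ be a complete metric space, let $D$ be a relatively dense subset of $\mathbb{R}^+$, and let $u\in BC(\mathbb{R}^+,X)$. The following statements are equivalent. (i) $u\in AAP(\mathbb{R}^+,X)$, i.e. $u$ is asymptotically almost periodic. (ii) The set $\{T^+_\tau u : \tau\in D\}$ is relatively compact in $(BC(\mathbb{R}^+,X),d_{\infty,+})$.
   Context: $\mathbb{R}^+=[0,+\infty)$. For a metric space $(X,d)$, $BC(\mathbb{R}^+,X)$ is the space of all bounded continuous functions from $\mathbb{R}^+$ to $X$, with the metric $d_{\infty,+}(u,v)=\sup_{t\ge 0}d(u(t),v(t))$. For $\tau\ge 0$ and $u\in BC(\mathbb{R}^+,X)$, the translate $T^+_\tau u\in BC(\mathbb{R}^+,X)$ is $T^+_\tau u(t)=u(t+\tau)$, $t\ge 0$. A subset $D$ of $\mathbb{R}$ (respectively of $\mathbb{R}^+$) is relatively dense in $\mathbb{R}$ (respectively in $\mathbb{R}^+$) if there is $\ell>0$ such that $D\cap[\alpha,\alpha+\ell]\neq\emptyset$ for all $\alpha\in\mathbb{R}$ (respectively for all $\alpha\ge 0$). A continuous function $v:\mathbb{R}\to X$ is almost periodic (in the sense of Bohr) if for each $\varepsilon>0$ the set $\{\tau\in\mathbb{R} : \sup_{t\in\mathbb{R}}d(v(t+\tau),v(t))\le\varepsilon\}$ is relatively dense in $\mathbb{R}$; $AP(\mathbb{R},X)$ denotes the set of such functions. A continuous function $u:\mathbb{R}^+\to X$ is asymptotically almost periodic if there exists $v\in AP(\mathbb{R},X)$ such that $\lim_{t\to+\infty}d(u(t),v(t))=0$;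 $AAP(\mathbb{R}^+,X)$ denotes the set of such functions. A subset of a metric space is relatively compact if its closure is compact. *)

theory Defs
  imports "HOL-Analysis.Analysis"
begin

text \<open>
  Metric spaces are elements of the library type \<open>'a metric\<close>, so the carrier need not
  be a whole type. The space \<open>cfunspace X m\<close> consists of the bounded continuous maps
  from \<open>X\<close> to \<open>m\<close> that are extensional on \<open>topspace X\<close> (they
  take the value \<open>undefined\<close> outside, so that they are determined by their values on
  \<open>topspace X\<close>), with the supremum metric.
\<close>

definition BC_half_line :: "'a metric \<Rightarrow> (real \<Rightarrow> 'a) metric" where
  "BC_half_line m = cfunspace (top_of_set {0..}) m"

definition translate_half_line :: "real \<Rightarrow> (real \<Rightarrow> 'a) \<Rightarrow> real \<Rightarrow> 'a" where
  "translate_half_line \<tau> u = restrict (\<lambda>t. u (t + \<tau>)) {0..}"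

text \<open>
  Only used with \<open>S = UNIV\<close> and \<open>S = {0..}\<close>.
\<close>

definition relatively_dense_in :: "real set \<Rightarrow> real set \<Rightarrow> bool" where
  "relatively_dense_in S D \<longleftrightarrow>
     D \<subseteq> S \<and> (\<exists>l>0. \<forall>\<alpha>\<in>S. D \<inter> {\<alpha>..\<alpha> + l} \<noteq> {})"

text \<open>
  The supremum below is taken in \<open>ereal\<close>, because for an arbitrary continuous
  \<open>v\<close> it may be infinite.
\<close>

definition almost_periodic :: "'a metric \<Rightarrow> (real \<Rightarrow> 'a) \<Rightarrow> bool" where
  "almost_periodic m v \<longleftrightarrow>
     continuous_map euclideanreal (mtopology_of m) v \<and>
     (\<forall>\<epsilon>>0. relatively_dense_in UNIV
        {\<tau>. (SUP t. ereal (mdist m (v (t + \<tau>)) (v t))) \<le> ereal \<epsilon>})"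

definition asymptotically_almost_periodic :: "'a metric \<Rightarrow> (real \<Rightarrow> 'a) \<Rightarrow> bool" where
  "asymptotically_almost_periodic m u \<longleftrightarrow>
     continuous_map (top_of_set {0..}) (mtopology_of m) u \<and>
     (\<exists>v. almost_periodic m v \<and> ((\<lambda>t. mdist m (u t) (v t)) \<longlongrightarrow> 0) at_top)"

definition relatively_compact_in :: "'a metric \<Rightarrow> 'a set \<Rightarrow> bool" where
  "relatively_compact_in m A \<longleftrightarrow>
     A \<subseteq> mspace m \<and> compactin (mtopology_of m) (mtopology_of m closure_of A)"

lemma mdist_BC_half_line:
  assumes "f \<in> mspace (BC_half_line m)" "g \<in> mspace (BC_half_line m)"
  shows "mdist (BC_half_line m) f g = (SUP t\<in>{0..}. mdist m (f t) (g t))"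
proof -
  interpret Metric_space "mspace m" "mdist m" by simp
  show ?thesis
    using assms
    by (auto simp: BC_half_line_def mdist_cfunspace_eq_mdist_funspace fdist_def fspace_def)
qed

lemma translate_half_line_in_BC:
  assumes "u \<in> mspace (BC_half_line m)" "0 \<le> \<tau>"
  shows "translate_half_line \<tau> u \<in> mspace (BC_half_line m)"
proof -
  interpret Metric_space "mspace m" "mdist m" by simp
  have c: "continuous_map (top_of_set {0..}) (mtopology_of m) u"
    and b: "mbounded (u ` {0..})" and r: "u \<in> {0..} \<rightarrow> mspace m"
    using assms(1) by (auto simp: BC_half_line_def)
  have sh: "continuous_map (top_of_set {0..}) (top_of_set {0..}) (\<lambda>t. t + \<tau>)"
    using assms(2) by (auto intro!: continuous_intros)
  have "continuous_map (top_of_set {0..}) (mtopology_of m) (translate_half_line \<tau> u)"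
    by (rule continuous_map_eq[OF continuous_map_compose[OF sh c]])
       (auto simp: translate_half_line_def)
  moreover have "mbounded (translate_half_line \<tau> u ` {0..})"
    by (rule mbounded_subset[OF b]) (use assms(2) in \<open>auto simp: translate_half_line_def\<close>)
  moreover have "translate_half_line \<tau> u \<in> {0..} \<rightarrow> mspace m"
    using r assms(2) by (auto simp: translate_half_line_def Pi_iff)
  ultimately show ?thesis
    by (auto simp: BC_half_line_def translate_half_line_def)
qed

end

theory Submission
  imports Defs
begin

text \<open>
  Both statements are equivalent to a third one, \<open>translates_near_bounded_shifts\<close>, which
  does not mention \<open>D\<close> or a limit function: up to an error \<open>\<epsilon>\<close>, every
  translate of \<open>u\<close> is already a translate by an amount from a bounded interval
  \<open>{0..L}\<close>.

  Compactness of the translates. The space of bounded continuous functions is complete, so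
  relative compactness is total boundedness. If the translates along \<open>D\<close> are totally
  bounded, finitely many of them suffice up to \<open>\<epsilon>\<close>, and a translate by an
  arbitrary amount is reached from one along \<open>D\<close> by a further shift no longer than the
  gaps of \<open>D\<close>; this gives the third statement. Conversely, the third statement forces
  \<open>u\<close> to be uniformly continuous, because two neighbouring points can be moved
  together into a compact interval. Hence the translates by amounts from \<open>{0..L}\<close> have
  a finite net, and so do all translates
  (\<open>near_bounded_shifts_imp_mtotally_bounded\<close>).

  Asymptotic almost periodicity. If \<open>u\<close> is asymptotic to an almost periodic
  \<open>v\<close>, almost periods of \<open>v\<close> bring every large shift back to a bounded one.
  Conversely, the third statement says that asymptotic almost periods \<open>p\<close>, for which
  \<open>u (s + p)\<close> is close to \<open>u s\<close> for all large \<open>s\<close>, occur with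
  bounded gaps. Choose asymptotic almost periods \<open>p n\<close> that tend to infinity and have
  errors tending to \<open>0\<close>. By total boundedness they can be chosen so that the translates
  of \<open>u\<close> by \<open>p n\<close> are uniformly Cauchy on the half-line. A shift by one more
  asymptotic almost period extends this to every ray \<open>{-A..}\<close>, so the translates
  converge, uniformly on every such ray, to a function \<open>v\<close> on the whole line. It is
  asymptotic to \<open>u\<close> because the errors of the \<open>p n\<close> vanish, and it is almost
  periodic because an inequality valid for \<open>u\<close> only at large times becomes valid for
  \<open>v\<close> at all times.
\<close>

section \<open>The metric space of bounded continuous functions on the half-line\<close>

lemma mdist_same: "x \<in> mspace m \<Longrightarrow> mdist m x x = 0"
  by simp

lemma BC_half_lineD:
  assumes "u \<in> mspace (BC_half_line m)"
  shows "0 \<le> t \<Longrightarrow> u t \<in> mspace m"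
    and "continuous_map (top_of_set {0..}) (mtopology_of m) u"
  using assms by (auto simp: BC_half_line_def)

lemma mdist_translates_le_iff:
  assumes "u \<in> mspace (BC_half_line m)" "0 \<le> \<sigma>" "0 \<le> \<tau>"
  shows "mdist (BC_half_line m) (translate_half_line \<sigma> u) (translate_half_line \<tau> u) \<le> \<epsilon>
     \<longleftrightarrow> (\<forall>t\<ge>0. mdist m (u (t + \<sigma>)) (u (t + \<tau>)) \<le> \<epsilon>)"
proof -
  have "translate_half_line \<sigma> u \<in> mspace (BC_half_line m)"
       "translate_half_line \<tau> u \<in> mspace (BC_half_line m)"
    using assms translate_half_line_in_BC by blast+
  then show ?thesis
    unfolding BC_half_line_def
    by (subst cfunspace_mdist_le) (auto simp: translate_half_line_def)
qed

lemma mcomplete_BC_half_line: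
  assumes "mcomplete_of m"
  shows "mcomplete_of (BC_half_line m)"
proof -
  interpret Metric_space "mspace m" "mdist m" by simp
  show ?thesis
    using mcomplete_cfunspace[of "top_of_set {0..}"] assms
    by (simp add: mcomplete_of_def BC_half_line_def Self_def)
qed

lemma relatively_compact_in_iff_mtotally_bounded:
  assumes "mcomplete_of m"
  shows "relatively_compact_in m A \<longleftrightarrow> Metric_space.mtotally_bounded (mspace m) (mdist m) A"
proof -
  interpret Metric_space "mspace m" "mdist m" by simp
  show ?thesis
    using assms mtotally_bounded_eq_compact_closure_of[of A]
    by (simp add: relatively_compact_in_def mcomplete_of_def mtopology_of_def)
qed

section \<open>Translates that stay close to boundedly shifted ones\<close>

definition translates_near_bounded_shifts :: "'a metric \<Rightarrow> (real \<Rightarrow> 'a) \<Rightarrow> bool" where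
  "translates_near_bounded_shifts m u \<longleftrightarrow>
     (\<forall>\<epsilon>>0. \<exists>L. \<forall>\<tau>\<ge>0. \<exists>\<sigma>\<in>{0..L}. \<forall>t\<ge>0. mdist m (u (t + \<tau>)) (u (t + \<sigma>)) \<le> \<epsilon>)"

text \<open>
  For large \<open>\<tau>\<close>, subtract an almost period of \<open>v\<close> that brings
  \<open>\<tau>\<close> back to a bounded interval beyond the time after which \<open>u\<close> and
  \<open>v\<close> are close; the error consists of two distances between \<open>u\<close> and
  \<open>v\<close> and one from the almost period.
\<close>

lemma asymptotically_almost_periodic_imp_near_bounded_shifts:
  assumes u: "u \<in> mspace (BC_half_line m)" and aap: "asymptotically_almost_periodic m u"
  shows "translates_near_bounded_shifts m u"
  unfolding translates_near_bounded_shifts_def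
proof (intro allI impI)
  fix \<epsilon> :: real assume "\<epsilon> > 0"
  obtain v where v: "almost_periodic m v" and lim: "((\<lambda>t. mdist m (u t) (v t)) \<longlongrightarrow> 0) at_top"
    using aap by (auto simp: asymptotically_almost_periodic_def)
  have vM: "v t \<in> mspace m" for t
    using v by (auto simp: almost_periodic_def continuous_map_def)
  have "\<forall>\<^sub>F t in at_top. mdist m (u t) (v t) < \<epsilon>/3"
    using order_tendstoD(2)[OF lim, of "\<epsilon>/3"] \<open>\<epsilon> > 0\<close> by simp
  then obtain M0 where M0: "\<And>t. t \<ge> M0 \<Longrightarrow> mdist m (u t) (v t) < \<epsilon>/3"
    by (auto simp: eventually_at_top_linorder)
  define M where "M = max M0 0"
  have M: "0 \<le> M" "\<And>t. t \<ge> M \<Longrightarrow> mdist m (u t) (v t) < \<epsilon>/3"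
    using M0 by (auto simp: M_def)
  have "\<epsilon>/3 > 0" using \<open>\<epsilon> > 0\<close> by simp
  then obtain l where "l > 0" and l: "\<And>\<alpha>. \<exists>p\<in>{\<alpha>..\<alpha>+l}. (SUP t. ereal (mdist m (v (t + p)) (v t))) \<le> ereal (\<epsilon>/3)"
    using v unfolding almost_periodic_def relatively_dense_in_def by blast
  show "\<exists>L. \<forall>\<tau>\<ge>0. \<exists>\<sigma>\<in>{0..L}. \<forall>t\<ge>0. mdist m (u (t + \<tau>)) (u (t + \<sigma>)) \<le> \<epsilon>"
  proof (intro exI allI impI)
    fix \<tau> :: real assume "\<tau> \<ge> 0"
    show "\<exists>\<sigma>\<in>{0..M + l}. \<forall>t\<ge>0. mdist m (u (t + \<tau>)) (u (t + \<sigma>)) \<le> \<epsilon>"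
    proof (cases "\<tau> \<le> M")
      case True
      then have "\<tau> \<in> {0..M + l}" using \<open>\<tau> \<ge> 0\<close> \<open>l > 0\<close> by auto
      moreover have "\<forall>t\<ge>0. mdist m (u (t + \<tau>)) (u (t + \<tau>)) \<le> \<epsilon>"
        using BC_half_lineD(1)[OF u] \<open>\<tau> \<ge> 0\<close> \<open>\<epsilon> > 0\<close> by (simp add: mdist_same)
      ultimately show ?thesis by blast
    next
      case False
      \<comment> \<open>the interval for the period \<open>p\<close> is chosen so that \<open>\<tau> - p\<close> lies in \<open>{M..M + l}\<close>\<close>
      obtain p where p: "p \<in> {\<tau> - M - l..\<tau> - M - l + l}"
        and sup: "(SUP t. ereal (mdist m (v (t + p)) (v t))) \<le> ereal (\<epsilon>/3)"
        using l by blast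
      have per: "mdist m (v (t + p)) (v t) \<le> \<epsilon>/3" for t
        using sup by (simp add: SUP_le_iff)
      have "mdist m (u (t + \<tau>)) (u (t + (\<tau> - p))) \<le> \<epsilon>" if "t \<ge> 0" for t
      proof -
        define a where "a = t + (\<tau> - p)"
        have a: "t + \<tau> = a + p" "M \<le> a" "M \<le> t + \<tau>"
          using p that False by (auto simp: a_def)
        have in_m: "u (a + p) \<in> mspace m" "u a \<in> mspace m"
          using BC_half_lineD(1)[OF u] a M(1) by auto
        have "mdist m (u (a + p)) (u a) \<le> mdist m (u (a + p)) (v (a + p)) + mdist m (v (a + p)) (u a)"
          by (rule mdist_triangle) (use in_m vM in auto)
        also have "mdist m (v (a + p)) (u a) \<le> mdist m (v (a + p)) (v a) + mdist m (v a) (u a)"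
          by (rule mdist_triangle) (use in_m vM in auto)
        finally show ?thesis
          using M(2)[of "a + p"] M(2)[of a] per[of a] a
          by (simp add: mdist_commute[of m "v a"] flip: a_def)
      qed
      moreover have "\<tau> - p \<in> {0..M + l}" using p M(1) by auto
      ultimately show ?thesis by blast
    qed
  qed
qed

section \<open>Total boundedness of the translates\<close>

text \<open>
  On \<open>{0..L+1}\<close> the function is uniformly continuous by compactness. The
  approximation of the translate by \<open>s\<close> holds at all times at once, so a pair
  \<open>s\<close>, \<open>t\<close> of points at distance at most \<open>1\<close> is moved into that
  interval with its distance unchanged.
\<close>

lemma near_bounded_shifts_imp_uniformly_continuous:
  assumes u: "u \<in> mspace (BC_half_line m)" and near: "translates_near_bounded_shifts m u"
    and "\<epsilon> > 0"
  obtains \<delta> where "\<delta> > 0"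
    "\<And>s t. \<lbrakk>0 \<le> s; 0 \<le> t; \<bar>s - t\<bar> < \<delta>\<rbrakk> \<Longrightarrow> mdist m (u s) (u t) \<le> \<epsilon>"
proof -
  note uM = BC_half_lineD(1)[OF u]
  have "\<epsilon>/3 > 0" using \<open>\<epsilon> > 0\<close> by simp
  then obtain L where L: "\<And>\<tau>. \<tau> \<ge> 0 \<Longrightarrow> \<exists>\<sigma>\<in>{0..L}. \<forall>t\<ge>0. mdist m (u (t + \<tau>)) (u (t + \<sigma>)) \<le> \<epsilon>/3"
    using near unfolding translates_near_bounded_shifts_def by blast
  have "continuous_map (top_of_set {0..L+1}) (mtopology_of m) u"
    by (rule continuous_map_from_subtopology_mono[OF BC_half_lineD(2)[OF u]]) auto
  then have "uniformly_continuous_map (submetric euclidean_metric {0..L+1}) m u"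
    by (intro continuous_imp_uniformly_continuous_map)
       (simp add: mtopology_of_submetric compact_space_subtopology)
  then have "\<exists>\<delta>>0. \<forall>s\<in>{0..L+1}. \<forall>t\<in>{0..L+1}. dist t s < \<delta> \<longrightarrow> mdist m (u t) (u s) < \<epsilon>/3"
    unfolding uniformly_continuous_map_def using \<open>\<epsilon>/3 > 0\<close>
    unfolding mspace_submetric mdist_submetric mspace_euclidean_metric mdist_euclidean_metric Int_UNIV_right
    by blast
  then obtain \<delta>0 where \<delta>0: "\<delta>0 > 0"
    and uc: "\<And>s t. \<lbrakk>s \<in> {0..L+1}; t \<in> {0..L+1}; dist t s < \<delta>0\<rbrakk> \<Longrightarrow> mdist m (u t) (u s) < \<epsilon>/3"
    by blast
  \<comment> \<open>the bound \<open>1\<close> keeps the shifted pair inside \<open>{0..L+1}\<close>\<close>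
  define \<delta> where "\<delta> = min \<delta>0 1"
  have ordered: "mdist m (u s) (u t) \<le> \<epsilon>" if "0 \<le> s" "s \<le> t" "t - s < \<delta>" for s t
  proof -
    \<comment> \<open>move both points back into the compact interval by one common shift\<close>
    obtain \<sigma> where \<sigma>: "\<sigma> \<in> {0..L}" and sh: "\<And>r. r \<ge> 0 \<Longrightarrow> mdist m (u (r + s)) (u (r + \<sigma>)) \<le> \<epsilon>/3"
      using L[OF \<open>0 \<le> s\<close>] by blast
    define r where "r = t - s"
    have r: "0 \<le> r" "r < \<delta>" using that by (auto simp: r_def)
    have t: "t = r + s" by (simp add: r_def)
    have in_m: "u s \<in> mspace m" "u \<sigma> \<in> mspace m" "u (r + s) \<in> mspace m" "u (r + \<sigma>) \<in> mspace m"
      using uM that \<sigma> r by auto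
    have "mdist m (u s) (u (r + s)) \<le> mdist m (u s) (u \<sigma>) + mdist m (u \<sigma>) (u (r + s))"
      by (rule mdist_triangle) (use in_m in auto)
    also have "mdist m (u \<sigma>) (u (r + s)) \<le> mdist m (u \<sigma>) (u (r + \<sigma>)) + mdist m (u (r + \<sigma>)) (u (r + s))"
      by (rule mdist_triangle) (use in_m in auto)
    finally show ?thesis
      using sh[of 0] sh[of r] uc[of "r + \<sigma>" \<sigma>] r \<sigma>
      by (simp add: t \<delta>_def dist_real_def mdist_commute[of m "u (r + \<sigma>)"])
  qed
  show thesis
  proof
    show "\<delta> > 0" using \<delta>0 by (simp add: \<delta>_def)
    show "mdist m (u s) (u t) \<le> \<epsilon>" if "0 \<le> s" "0 \<le> t" "\<bar>s - t\<bar> < \<delta>" for s t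
      using ordered[of s t] ordered[of t s] that mdist_commute[of m "u s" "u t"] by linarith
  qed
qed

text \<open>
  By uniform continuity of \<open>u\<close>, nearby shifts give uniformly close translates. A finite
  net of the interval \<open>{0..L}\<close> of shifts therefore yields a finite net for the
  translates.
\<close>

lemma near_bounded_shifts_imp_mtotally_bounded:
  assumes u: "u \<in> mspace (BC_half_line m)" and near: "translates_near_bounded_shifts m u"
  shows "Metric_space.mtotally_bounded (mspace (BC_half_line m)) (mdist (BC_half_line m))
           ((\<lambda>\<tau>. translate_half_line \<tau> u) ` {0..})"
proof -
  interpret BC: Metric_space "mspace (BC_half_line m)" "mdist (BC_half_line m)" by simp
  note uM = BC_half_lineD(1)[OF u]
  let ?T = "\<lambda>\<tau>. translate_half_line \<tau> u"
  show ?thesis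
    unfolding BC.mtotally_bounded_def
  proof (intro allI impI)
    fix \<epsilon> :: real assume "\<epsilon> > 0"
    then have "\<epsilon>/3 > 0" by simp
    then obtain L where L: "\<And>\<tau>. \<tau> \<ge> 0 \<Longrightarrow> \<exists>\<sigma>\<in>{0..L}. \<forall>t\<ge>0. mdist m (u (t + \<tau>)) (u (t + \<sigma>)) \<le> \<epsilon>/3"
      using near unfolding translates_near_bounded_shifts_def by blast
    obtain \<delta> where "\<delta> > 0"
      and \<delta>: "\<And>s t. \<lbrakk>0 \<le> s; 0 \<le> t; \<bar>s - t\<bar> < \<delta>\<rbrakk> \<Longrightarrow> mdist m (u s) (u t) \<le> \<epsilon>/3"
      using near_bounded_shifts_imp_uniformly_continuous[OF u near \<open>\<epsilon>/3 > 0\<close>] by blast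
    have "{0..L} \<subseteq> (\<Union>x\<in>{0..L}. ball x \<delta>)"
      using \<open>\<delta> > 0\<close> by auto
    then obtain F where F: "F \<subseteq> {0..L}" "finite F" "{0..L} \<subseteq> (\<Union>x\<in>F. ball x \<delta>)"
      using compactE_image[OF compact_Icc, of "{0..L}" "\<lambda>x. ball x \<delta>" 0 L] by auto
    show "\<exists>K. finite K \<and> K \<subseteq> ?T ` {0..} \<and> ?T ` {0..} \<subseteq> (\<Union>x\<in>K. BC.mball x \<epsilon>)"
    proof (intro exI conjI)
      show "finite (?T ` F)" using F(2) by simp
      show "?T ` F \<subseteq> ?T ` {0..}" using F(1) by auto
      show "?T ` {0..} \<subseteq> (\<Union>x\<in>?T ` F. BC.mball x \<epsilon>)"
      proof (rule image_subsetI)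
        fix \<tau> :: real assume "\<tau> \<in> {0..}"
        then have "\<tau> \<ge> 0" by simp
        obtain \<sigma> where \<sigma>: "\<sigma> \<in> {0..L}" "\<forall>t\<ge>0. mdist m (u (t + \<tau>)) (u (t + \<sigma>)) \<le> \<epsilon>/3"
          using L[OF \<open>\<tau> \<ge> 0\<close>] by blast
        obtain x where x: "x \<in> F" "\<bar>x - \<sigma>\<bar> < \<delta>"
          using F(3) \<sigma>(1) by (fastforce simp: dist_real_def)
        have "x \<ge> 0" "\<sigma> \<ge> 0" using x F(1) \<sigma>(1) by auto
        have in_BC: "?T x \<in> mspace (BC_half_line m)" "?T \<tau> \<in> mspace (BC_half_line m)"
          "?T \<sigma> \<in> mspace (BC_half_line m)"
          using translate_half_line_in_BC[OF u] \<open>x \<ge> 0\<close> \<open>\<tau> \<ge> 0\<close> \<open>\<sigma> \<ge> 0\<close> by auto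
        have "mdist (BC_half_line m) (?T x) (?T \<sigma>) \<le> \<epsilon>/3"
          using \<delta> x \<open>x \<ge> 0\<close> \<open>\<sigma> \<ge> 0\<close> by (subst mdist_translates_le_iff[OF u]) auto
        moreover have "mdist (BC_half_line m) (?T \<tau>) (?T \<sigma>) \<le> \<epsilon>/3"
          using \<sigma> \<open>\<tau> \<ge> 0\<close> by (subst mdist_translates_le_iff[OF u]) auto
        ultimately have "mdist (BC_half_line m) (?T x) (?T \<tau>) < \<epsilon>"
          using BC.triangle[of "?T x" "?T \<sigma>" "?T \<tau>"] BC.commute[of "?T \<sigma>" "?T \<tau>"] in_BC \<open>\<epsilon> > 0\<close>
          by linarith
        then show "?T \<tau> \<in> (\<Union>x\<in>?T ` F. BC.mball x \<epsilon>)"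
          using x(1) in_BC by auto
      qed
    qed
  qed
qed

text \<open>
  A closeness of two translates persists under a further common shift. Writing \<open>\<tau>\<close>
  as an element \<open>d\<close> of \<open>D\<close> plus a remainder of length at most the gap
  \<open>l\<close>, and replacing \<open>d\<close> by a member of the finite net, bounds the shift.
\<close>

lemma mtotally_bounded_imp_near_bounded_shifts:
  assumes u: "u \<in> mspace (BC_half_line m)" and D: "relatively_dense_in {0..} D"
    and tb: "Metric_space.mtotally_bounded (mspace (BC_half_line m)) (mdist (BC_half_line m))
           ((\<lambda>\<tau>. translate_half_line \<tau> u) ` D)"
  shows "translates_near_bounded_shifts m u"
  unfolding translates_near_bounded_shifts_def
proof (intro allI impI)
  interpret BC: Metric_space "mspace (BC_half_line m)" "mdist (BC_half_line m)" by simp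
  let ?T = "\<lambda>\<tau>. translate_half_line \<tau> u"
  fix \<epsilon> :: real assume "\<epsilon> > 0"
  obtain l where "l > 0" and l: "\<And>\<alpha>. \<alpha> \<ge> 0 \<Longrightarrow> D \<inter> {\<alpha>..\<alpha> + l} \<noteq> {}" and D0: "D \<subseteq> {0..}"
    using D unfolding relatively_dense_in_def by auto
  obtain K where K: "finite K" "K \<subseteq> ?T ` D" "?T ` D \<subseteq> (\<Union>x\<in>K. BC.mball x \<epsilon>)"
    using tb[unfolded BC.mtotally_bounded_def, rule_format, OF \<open>\<epsilon> > 0\<close>]
    by (elim exE conjE) (rule that)
  obtain F where F: "F \<subseteq> D" "finite F" "K = ?T ` F"
    using finite_subset_image[OF K(1,2)] by blast
  define L where "L = Max (insert 0 F)"
  have L: "0 \<le> L" "\<And>x. x \<in> F \<Longrightarrow> x \<le> L"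
    using F(2) by (auto simp: L_def)
  show "\<exists>L. \<forall>\<tau>\<ge>0. \<exists>\<sigma>\<in>{0..L}. \<forall>t\<ge>0. mdist m (u (t + \<tau>)) (u (t + \<sigma>)) \<le> \<epsilon>"
  proof (intro exI allI impI)
    fix \<tau> :: real assume "\<tau> \<ge> 0"
    show "\<exists>\<sigma>\<in>{0..L + l}. \<forall>t\<ge>0. mdist m (u (t + \<tau>)) (u (t + \<sigma>)) \<le> \<epsilon>"
    proof (cases "\<tau> \<le> l")
      case True
      then have "\<tau> \<in> {0..L + l}" using \<open>\<tau> \<ge> 0\<close> L(1) by auto
      moreover have "\<forall>t\<ge>0. mdist m (u (t + \<tau>)) (u (t + \<tau>)) \<le> \<epsilon>"
        using BC_half_lineD(1)[OF u] \<open>\<tau> \<ge> 0\<close> \<open>\<epsilon> > 0\<close> by (simp add: mdist_same)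
      ultimately show ?thesis by blast
    next
      case False
      then obtain d where d: "d \<in> D" "\<tau> - l \<le> d" "d \<le> \<tau>"
        using l[of "\<tau> - l"] by auto
      then obtain x where x: "x \<in> F" "?T d \<in> BC.mball (?T x) \<epsilon>"
        using K(3) F(3) by blast
      have "d \<ge> 0" "x \<ge> 0" using d x F(1) D0 by auto
      have "mdist (BC_half_line m) (?T d) (?T x) \<le> \<epsilon>"
        using x(2) by (simp add: BC.commute)
      then have dx: "mdist m (u (t + d)) (u (t + x)) \<le> \<epsilon>" if "t \<ge> 0" for t
        using that mdist_translates_le_iff[OF u \<open>d \<ge> 0\<close> \<open>x \<ge> 0\<close>] by blast
      have "mdist m (u (t + \<tau>)) (u (t + (x + (\<tau> - d)))) \<le> \<epsilon>" if "t \<ge> 0" for t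
        using dx[of "t + (\<tau> - d)"] that d by (simp add: algebra_simps)
      moreover have "x + (\<tau> - d) \<in> {0..L + l}"
        using d L(2)[OF x(1)] \<open>x \<ge> 0\<close> by auto
      ultimately show ?thesis by blast
    qed
  qed
qed

section \<open>Asymptotic almost periods\<close>

text \<open>
  If the translates by \<open>\<tau>\<close> and by \<open>\<sigma> \<le> L\<close> are close, then
  \<open>\<tau> - \<sigma>\<close> is an almost period of \<open>u\<close> from time \<open>\<sigma>\<close>
  on. One constant \<open>L\<close> serves both as the gap length and as the starting time.
\<close>

lemma near_bounded_shifts_imp_asymptotic_periods:
  assumes near: "translates_near_bounded_shifts m u" and "\<epsilon> > 0"
  obtains L where "L > 0"
    "\<And>\<alpha>. \<alpha> \<ge> 0 \<Longrightarrow> \<exists>p\<in>{\<alpha>..\<alpha> + L}. \<forall>s\<ge>L. mdist m (u (s + p)) (u s) \<le> \<epsilon>"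
proof -
  obtain L0 where L0: "\<And>\<tau>. \<tau> \<ge> 0 \<Longrightarrow> \<exists>\<sigma>\<in>{0..L0}. \<forall>t\<ge>0. mdist m (u (t + \<tau>)) (u (t + \<sigma>)) \<le> \<epsilon>"
    using assms unfolding translates_near_bounded_shifts_def by blast
  define L where "L = max L0 1"
  show thesis
  proof
    show "L > 0" by (simp add: L_def)
    fix \<alpha> :: real assume "\<alpha> \<ge> 0"
    then obtain \<sigma> where \<sigma>: "\<sigma> \<in> {0..L0}" "\<And>t. t \<ge> 0 \<Longrightarrow> mdist m (u (t + (\<alpha> + L))) (u (t + \<sigma>)) \<le> \<epsilon>"
      using L0[of "\<alpha> + L"] \<open>L > 0\<close> by auto
    have "mdist m (u (s + (\<alpha> + L - \<sigma>))) (u s) \<le> \<epsilon>" if "s \<ge> L" for s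
      using \<sigma>(2)[of "s - \<sigma>"] \<sigma>(1) that by (simp add: L_def algebra_simps)
    moreover have "\<alpha> + L - \<sigma> \<in> {\<alpha>..\<alpha> + L}"
      using \<sigma>(1) by (auto simp: L_def)
    ultimately show "\<exists>p\<in>{\<alpha>..\<alpha> + L}. \<forall>s\<ge>L. mdist m (u (s + p)) (u s) \<le> \<epsilon>"
      by blast
  qed
qed

text \<open>
  Passing to a subsequence for which the translates are Cauchy only improves the growth of
  \<open>p n\<close> and the errors.
\<close>

lemma Cauchy_sequence_of_asymptotic_periods:
  assumes u: "u \<in> mspace (BC_half_line m)" and near: "translates_near_bounded_shifts m u"
  obtains p L :: "nat \<Rightarrow> real" where
    "\<And>n. p n \<ge> real n"
    "\<And>n s. s \<ge> L n \<Longrightarrow> mdist m (u (s + p n)) (u s) \<le> 1 / Suc n"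
    "\<And>\<epsilon>. \<epsilon> > 0 \<Longrightarrow> \<exists>N. \<forall>j\<ge>N. \<forall>k\<ge>N. \<forall>t\<ge>0. mdist m (u (t + p j)) (u (t + p k)) \<le> \<epsilon>"
proof -
  interpret BC: Metric_space "mspace (BC_half_line m)" "mdist (BC_half_line m)" by simp
  let ?T = "\<lambda>\<tau>. translate_half_line \<tau> u"
  have "\<exists>q L. q \<ge> real n \<and> (\<forall>s\<ge>L. mdist m (u (s + q)) (u s) \<le> 1 / Suc n)" for n
  proof -
    obtain L where "\<And>\<alpha>. \<alpha> \<ge> 0 \<Longrightarrow> \<exists>p\<in>{\<alpha>..\<alpha> + L}. \<forall>s\<ge>L. mdist m (u (s + p)) (u s) \<le> 1 / Suc n"
      by (rule near_bounded_shifts_imp_asymptotic_periods[OF near, of "1 / Suc n"]) auto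
    from this[of "real n"] obtain p where "p \<in> {real n..real n + L}"
      "\<forall>s\<ge>L. mdist m (u (s + p)) (u s) \<le> 1 / Suc n" by auto
    then show ?thesis by (intro exI[of _ p] exI[of _ L]) simp
  qed
  then obtain q L where q: "\<And>n. q n \<ge> real n"
    and qL: "\<And>n s. s \<ge> L n \<Longrightarrow> mdist m (u (s + q n)) (u s) \<le> 1 / Suc n"
    by metis
  have q0: "q n \<ge> 0" for n
    using q[of n] by (meson of_nat_0_le_iff order_trans)
  then have "range (\<lambda>n. ?T (q n)) \<subseteq> ?T ` {0..}" by auto
  then obtain r where "strict_mono r" and Cau: "BC.MCauchy ((\<lambda>n. ?T (q n)) \<circ> r)"
    using near_bounded_shifts_imp_mtotally_bounded[OF u near] unfolding BC.mtotally_bounded_sequentially by meson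
  have rn: "n \<le> r n" for n
    by (rule strict_mono_imp_increasing[OF \<open>strict_mono r\<close>])
  show thesis
  proof
    show "q (r n) \<ge> real n" for n
      using q[of "r n"] rn[of n] by linarith
    show "mdist m (u (s + q (r n))) (u s) \<le> 1 / Suc n" if "s \<ge> L (r n)" for n s
    proof -
      have "1 / real (Suc (r n)) \<le> 1 / real (Suc n)"
        using rn[of n] by (intro divide_left_mono) auto
      then show ?thesis using qL[OF that] by linarith
    qed
    fix \<epsilon> :: real assume "\<epsilon> > 0"
    then obtain N where N: "\<And>j k. \<lbrakk>N \<le> j; N \<le> k\<rbrakk> \<Longrightarrow> mdist (BC_half_line m) (?T (q (r j))) (?T (q (r k))) < \<epsilon>"
      using Cau unfolding BC.MCauchy_def o_def by meson
    show "\<exists>N. \<forall>j\<ge>N. \<forall>k\<ge>N. \<forall>t\<ge>0. mdist m (u (t + q (r j))) (u (t + q (r k))) \<le> \<epsilon>"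
      using less_imp_le[OF N] mdist_translates_le_iff[OF u q0 q0] by blast
  qed
qed

section \<open>The almost periodic limit function\<close>

text \<open>
  Continuity is a local property, and around each point the convergence is uniform on an open
  ray.
\<close>

lemma (in Metric_space) uniformly_Cauchy_on_right_rays_limit:
  fixes w :: "nat \<Rightarrow> real \<Rightarrow> 'a"
  assumes "mcomplete" and cont: "\<And>n. continuous_map euclideanreal mtopology (w n)"
    and Cau: "\<And>A \<epsilon>. \<epsilon> > 0 \<Longrightarrow> \<exists>N. \<forall>j\<ge>N. \<forall>k\<ge>N. \<forall>t\<ge>-A. d (w j t) (w k t) \<le> \<epsilon>"
  obtains v where "continuous_map euclideanreal mtopology v"
    "\<And>A \<epsilon>. \<epsilon> > 0 \<Longrightarrow> \<exists>N. \<forall>n\<ge>N. \<forall>t\<ge>-A. d (w n t) (v t) \<le> \<epsilon>"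
proof -
  have wM: "w n t \<in> M" for n t
    using cont[of n] by (auto simp: continuous_map_def)
  have "\<exists>l. limitin mtopology (\<lambda>n. w n t) l sequentially" for t
  proof -
    have "MCauchy (\<lambda>n. w n t)"
      unfolding MCauchy_def
    proof (intro conjI allI impI)
      fix \<epsilon> :: real assume "\<epsilon> > 0"
      then have "\<epsilon>/2 > 0" by simp
      from Cau[OF this, of "-t"] obtain N where "\<forall>j\<ge>N. \<forall>k\<ge>N. d (w j t) (w k t) \<le> \<epsilon>/2" by auto
      then show "\<exists>N. \<forall>n n'. N \<le> n \<longrightarrow> N \<le> n' \<longrightarrow> d (w n t) (w n' t) < \<epsilon>"
        using \<open>\<epsilon> > 0\<close> by (intro exI[of _ N]) (smt (verit) field_sum_of_halves)
    qed (use wM in auto)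
    then show ?thesis using \<open>mcomplete\<close> by (auto simp: mcomplete_def)
  qed
  then obtain v where v: "\<And>t. limitin mtopology (\<lambda>n. w n t) (v t) sequentially" by metis
  have vM: "v t \<in> M" for t using v limitin_mspace by blast
  have unif: "\<exists>N. \<forall>n\<ge>N. \<forall>t\<ge>-A. d (w n t) (v t) \<le> \<epsilon>" if "\<epsilon> > 0" for A \<epsilon> :: real
  proof -
    obtain N where N: "\<And>j k t. \<lbrakk>j \<ge> N; k \<ge> N; t \<ge> -A\<rbrakk> \<Longrightarrow> d (w j t) (w k t) \<le> \<epsilon>"
      using Cau[OF \<open>\<epsilon> > 0\<close>] by blast
    have "d (w n t) (v t) \<le> \<epsilon>" if "n \<ge> N" "t \<ge> -A" for n t
    proof (rule field_le_epsilon)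
      fix \<eta> :: real assume "\<eta> > 0"
      then obtain P where P: "\<And>k. k \<ge> P \<Longrightarrow> d (w k t) (v t) < \<eta>"
        using v[of t] unfolding limit_metric_sequentially by blast
      show "d (w n t) (v t) \<le> \<epsilon> + \<eta>"
        using triangle[of "w n t" "w (max N P) t" "v t"] wM vM N[of n "max N P" t] P[of "max N P"] that
        by simp
    qed
    then show ?thesis by blast
  qed
  have "continuous_map euclideanreal mtopology v"
    unfolding continuous_map_to_metric
  proof (intro ballI allI impI)
    fix x \<epsilon> :: real assume "\<epsilon> > 0"
    have "continuous_map (top_of_set {x - 1<..}) mtopology v"
    proof (rule continuous_map_uniform_limit_alt)
      show "\<forall>\<^sub>F n in sequentially. continuous_map (top_of_set {x - 1<..}) mtopology (w n)"
        using cont by (intro always_eventually allI continuous_map_from_subtopology)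
      show "v \<in> topspace (top_of_set {x - 1<..}) \<rightarrow> M" using vM by auto
      fix \<eta> :: real assume "\<eta> > 0"
      then have "\<eta>/2 > 0" by simp
      from unif[OF this, of "1 - x"] obtain N where N: "\<forall>n\<ge>N. \<forall>t\<ge>x - 1. d (w n t) (v t) \<le> \<eta>/2"
        by auto
      show "\<forall>\<^sub>F n in sequentially. \<forall>t\<in>topspace (top_of_set {x - 1<..}). d (w n t) (v t) < \<eta>"
        unfolding eventually_sequentially
      proof (intro exI[of _ N] allI impI ballI)
        fix n t assume "n \<ge> N" "t \<in> topspace (top_of_set {x - 1<..})"
        then have "d (w n t) (v t) \<le> \<eta>/2" using N by simp
        then show "d (w n t) (v t) < \<eta>" using \<open>\<eta> > 0\<close> by simp
      qed
    qed auto
    then obtain U where "openin (top_of_set {x - 1<..}) U" "x \<in> U" "\<forall>y\<in>U. v y \<in> mball (v x) \<epsilon>"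
      using continuous_map_to_metric[THEN iffD1, rule_format, of "top_of_set {x - 1<..}" v x \<epsilon>]
        \<open>\<epsilon> > 0\<close> by auto
    then show "\<exists>U. openin euclideanreal U \<and> x \<in> U \<and> (\<forall>y\<in>U. v y \<in> mball (v x) \<epsilon>)"
      using openin_open_trans[of "{x - 1<..}" U] by (intro exI[of _ U]) simp
  qed
  then show thesis using unif that by blast
qed

text \<open>
  The almost periodic function is the limit of \<open>u (t + p n)\<close>, where \<open>p n\<close>
  are asymptotic almost periods that tend to infinity with vanishing errors.
\<close>

lemma near_bounded_shifts_imp_asymptotically_almost_periodic:
  assumes "mcomplete_of m" and u: "u \<in> mspace (BC_half_line m)"
    and near: "translates_near_bounded_shifts m u"
  shows "asymptotically_almost_periodic m u"
proof -
  interpret Metric_space "mspace m" "mdist m" by simp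
  note uM = BC_half_lineD(1)[OF u]
  obtain p L :: "nat \<Rightarrow> real" where p: "\<And>n. p n \<ge> real n"
    and pL: "\<And>n s. s \<ge> L n \<Longrightarrow> mdist m (u (s + p n)) (u s) \<le> 1 / Suc n"
    and pC: "\<And>\<epsilon>. \<epsilon> > 0 \<Longrightarrow> \<exists>N. \<forall>j\<ge>N. \<forall>k\<ge>N. \<forall>t\<ge>0. mdist m (u (t + p j)) (u (t + p k)) \<le> \<epsilon>"
    using Cauchy_sequence_of_asymptotic_periods[OF u near] by blast
  \<comment> \<open>the value stays at \<open>u 0\<close> for \<open>t < - p n\<close>, which keeps \<open>w n\<close> continuous on the whole line\<close>
  define w where "w = (\<lambda>n t. u (max 0 (t + p n)))"
  have w_eq: "w n t = u (t + p n)" if "t + real n \<ge> 0" for n t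
    using that p[of n] by (simp add: w_def)
  have wM: "w n t \<in> mspace m" for n t
    by (simp add: w_def uM)
  have w_cont: "continuous_map euclideanreal mtopology (w n)" for n
  proof -
    have "continuous_map euclideanreal (top_of_set {0..}) (\<lambda>t. max 0 (t + p n))"
      by (intro continuous_map_into_subtopology) (auto intro!: continuous_intros)
    from continuous_map_compose[OF this BC_half_lineD(2)[OF u]]
    show ?thesis by (simp add: w_def o_def mtopology_of_def)
  qed
  have w_Cauchy: "\<exists>N. \<forall>j\<ge>N. \<forall>k\<ge>N. \<forall>t\<ge>-A. mdist m (w j t) (w k t) \<le> \<epsilon>" if "\<epsilon> > 0" for A \<epsilon> :: real
  proof -
    have "\<epsilon>/3 > 0" using that by simp
    then obtain N where N: "\<And>j k t. \<lbrakk>j \<ge> N; k \<ge> N; t \<ge> 0\<rbrakk> \<Longrightarrow> mdist m (u (t + p j)) (u (t + p k)) \<le> \<epsilon>/3"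
      using pC by blast
    obtain l where l: "\<And>\<alpha>. \<alpha> \<ge> 0 \<Longrightarrow> \<exists>q\<in>{\<alpha>..\<alpha> + l}. \<forall>s\<ge>l. mdist m (u (s + q)) (u s) \<le> \<epsilon>/3" and "l > 0"
      using near_bounded_shifts_imp_asymptotic_periods[OF near \<open>\<epsilon>/3 > 0\<close>] by blast
    \<comment> \<open>an almost period that moves \<open>{-A..}\<close> into the half-line\<close>
    obtain q where q: "q \<ge> max 0 A" "\<And>s. s \<ge> l \<Longrightarrow> mdist m (u (s + q)) (u s) \<le> \<epsilon>/3"
      using l[of "max 0 A"] by auto
    obtain P where P: "real P \<ge> l + A" using real_arch_simple by blast
    have "mdist m (w j t) (w k t) \<le> \<epsilon>" if "j \<ge> max N P" "k \<ge> max N P" "t \<ge> -A" for j k t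
    proof -
      have ge: "t + real j \<ge> l" "t + real k \<ge> l" using that P by linarith+
      then have pg: "t + p j \<ge> l" "t + p k \<ge> l" using p[of j] p[of k] by linarith+
      let ?a = "u (t + p j)" and ?b = "u (t + p k)" and ?a' = "u (t + p j + q)" and ?b' = "u (t + p k + q)"
      have in_m: "?a \<in> mspace m" "?b \<in> mspace m" "?a' \<in> mspace m" "?b' \<in> mspace m"
        using uM pg q(1) \<open>l > 0\<close> by auto
      have "mdist m ?a' ?b' \<le> \<epsilon>/3"
        using N[of j k "t + q"] that q(1) by (simp add: algebra_simps)
      moreover have "mdist m ?a' ?a \<le> \<epsilon>/3" "mdist m ?b' ?b \<le> \<epsilon>/3"
        using q(2) pg by auto
      ultimately have "mdist m ?a ?b \<le> \<epsilon>"
        using triangle[of ?a ?a' ?b] triangle[of ?a' ?b' ?b] commute[of ?a ?a'] in_m by linarith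
      then show ?thesis using w_eq ge \<open>l > 0\<close> by simp
    qed
    then show ?thesis by blast
  qed
  obtain v where v_cont: "continuous_map euclideanreal mtopology v"
    and v: "\<And>A \<epsilon>. \<epsilon> > 0 \<Longrightarrow> \<exists>N. \<forall>n\<ge>N. \<forall>t\<ge>-A. mdist m (w n t) (v t) \<le> \<epsilon>"
    using uniformly_Cauchy_on_right_rays_limit[OF _ w_cont w_Cauchy] \<open>mcomplete_of m\<close>
    unfolding mcomplete_of_def by blast
  have vM: "v t \<in> mspace m" for t
    using v_cont by (auto simp: continuous_map_def)
  have lim: "((\<lambda>t. mdist m (u t) (v t)) \<longlongrightarrow> 0) at_top"
  proof (rule tendstoI)
    fix \<epsilon> :: real assume "\<epsilon> > 0"
    then have "\<epsilon>/3 > 0" by simp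
    from v[OF this, of 0] obtain N where N: "\<And>n t. \<lbrakk>n \<ge> N; t \<ge> 0\<rbrakk> \<Longrightarrow> mdist m (w n t) (v t) \<le> \<epsilon>/3"
      by auto
    obtain n0 where "inverse (real (Suc n0)) < \<epsilon>/3"
      using reals_Archimedean[OF \<open>\<epsilon>/3 > 0\<close>] by blast
    define n where "n = max N n0"
    have "1 / real (Suc n) \<le> 1 / real (Suc n0)"
      by (intro divide_left_mono) (auto simp: n_def)
    then have n: "1 / real (Suc n) < \<epsilon>/3" 
      using \<open>inverse (real (Suc n0)) < \<epsilon>/3\<close> by (simp add: inverse_eq_divide)
    have "dist (mdist m (u t) (v t)) 0 < \<epsilon>" if "t \<ge> max 0 (L n)" for t
    proof -
      have "mdist m (w n t) (u t) \<le> 1 / Suc n"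
        using pL[of n t] w_eq[of t n] that by simp
      moreover have "mdist m (w n t) (v t) \<le> \<epsilon>/3"
        using N[of n t] that by (simp add: n_def)
      moreover have "u t \<in> mspace m" using uM that by simp
      ultimately have "mdist m (u t) (v t) < \<epsilon>"
        using triangle[of "u t" "w n t" "v t"] commute[of "u t" "w n t"] wM[of n t] vM[of t] n \<open>\<epsilon> > 0\<close>
        by linarith
      then show ?thesis by simp
    qed
    then show "\<forall>\<^sub>F t in at_top. dist (mdist m (u t) (v t)) 0 < \<epsilon>"
      unfolding eventually_at_top_linorder by blast
  qed
  \<comment> \<open>an asymptotic almost period of \<open>u\<close> holds for \<open>v\<close> at all times, as \<open>t + p n\<close> is eventually large\<close>
  have period: "mdist m (v (t + q)) (v t) \<le> \<epsilon>"
    if q: "q \<ge> 0" "\<And>s. s \<ge> l \<Longrightarrow> mdist m (u (s + q)) (u s) \<le> \<epsilon>" for q l \<epsilon> t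
  proof (rule field_le_epsilon)
    fix \<eta> :: real assume "\<eta> > 0"
    then have "\<eta>/2 > 0" by simp
    from v[OF this, of "-t"] obtain N where N: "\<And>n s. \<lbrakk>n \<ge> N; s \<ge> t\<rbrakk> \<Longrightarrow> mdist m (w n s) (v s) \<le> \<eta>/2"
      by auto
    obtain P where P: "real P \<ge> max l 0 - t" using real_arch_simple by blast
    define n where "n = max N P"
    have n: "t + real n \<ge> max l 0"
    proof -
      have "real P \<le> real n" by (simp add: n_def)
      then show ?thesis using P by linarith
    qed
    then have "t + p n \<ge> l" using p[of n] by linarith
    then have "mdist m (w n (t + q)) (w n t) \<le> \<epsilon>"
      using q(2)[of "t + p n"] w_eq[of t n] w_eq[of "t + q" n] n q(1) by (simp add: algebra_simps)
    moreover have "mdist m (w n (t + q)) (v (t + q)) \<le> \<eta>/2" "mdist m (w n t) (v t) \<le> \<eta>/2"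
      using N q(1) by (auto simp: n_def)
    ultimately show "mdist m (v (t + q)) (v t) \<le> \<epsilon> + \<eta>"
      using triangle[of "v (t + q)" "w n (t + q)" "v t"] triangle[of "w n (t + q)" "w n t" "v t"]
        commute[of "v (t + q)" "w n (t + q)"] wM[of n t] wM[of n "t + q"] vM[of t] vM[of "t + q"]
      by linarith
  qed
  have "almost_periodic m v"
    unfolding almost_periodic_def
  proof (intro conjI allI impI)
    show "continuous_map euclideanreal (mtopology_of m) v"
      using v_cont by (simp add: mtopology_of_def)
    fix \<epsilon> :: real assume "\<epsilon> > 0"
    let ?E = "{\<tau>. (SUP t. ereal (mdist m (v (t + \<tau>)) (v t))) \<le> ereal \<epsilon>}"
    have E_iff: "\<tau> \<in> ?E \<longleftrightarrow> (\<forall>t. mdist m (v (t + \<tau>)) (v t) \<le> \<epsilon>)" for \<tau>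
      by (simp add: SUP_le_iff)
    have neg: "- \<tau> \<in> ?E" if "\<tau> \<in> ?E" for \<tau>
      unfolding E_iff
    proof
      fix t
      show "mdist m (v (t + - \<tau>)) (v t) \<le> \<epsilon>"
        using that[unfolded E_iff, rule_format, of "t - \<tau>"] by (simp add: commute)
    qed
    obtain l where "l > 0"
      and l: "\<And>\<alpha>. \<alpha> \<ge> 0 \<Longrightarrow> \<exists>q\<in>{\<alpha>..\<alpha> + l}. \<forall>s\<ge>l. mdist m (u (s + q)) (u s) \<le> \<epsilon>"
      using near_bounded_shifts_imp_asymptotic_periods[OF near \<open>\<epsilon> > 0\<close>] by blast
    have pos: "\<exists>q\<in>{\<alpha>..\<alpha> + l}. q \<in> ?E" if "\<alpha> \<ge> 0" for \<alpha>
    proof -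
      obtain q where q: "q \<in> {\<alpha>..\<alpha> + l}" "\<forall>s\<ge>l. mdist m (u (s + q)) (u s) \<le> \<epsilon>"
        using l[OF \<open>\<alpha> \<ge> 0\<close>] by blast
      then have "\<forall>t. mdist m (v (t + q)) (v t) \<le> \<epsilon>"
        using period[of q l \<epsilon>] that by auto
      then show ?thesis using q(1) E_iff by blast
    qed
    \<comment> \<open>the set of almost periods is symmetric and contains \<open>0\<close>, so nonnegative ones suffice\<close>
    have "?E \<inter> {\<alpha>..\<alpha> + l} \<noteq> {}" for \<alpha>
    proof -
      consider "\<alpha> \<ge> 0" | "\<alpha> + l \<le> 0" | "\<alpha> < 0" "0 < \<alpha> + l" by linarith
      then show ?thesis
      proof cases
        case 1
        then show ?thesis using pos by blast
      next
        case 2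
        then obtain q where "q \<in> {- (\<alpha> + l)..- (\<alpha> + l) + l}" "q \<in> ?E"
          using pos[of "- (\<alpha> + l)"] by auto
        then have "- q \<in> {\<alpha>..\<alpha> + l}" "- q \<in> ?E" using neg by auto
        then show ?thesis by blast
      next
        case 3
        have "0 \<in> ?E" unfolding E_iff using vM \<open>\<epsilon> > 0\<close> by (simp add: mdist_same)
        moreover have "0 \<in> {\<alpha>..\<alpha> + l}" using 3 by auto
        ultimately show ?thesis by blast
      qed
    qed
    then show "relatively_dense_in UNIV ?E"
      unfolding relatively_dense_in_def using \<open>l > 0\<close> by blast
  qed
  then show ?thesis
    unfolding asymptotically_almost_periodic_def using BC_half_lineD(2)[OF u] lim by blast
qed

section \<open>Characterization by relative compactness\<close>

theorem corollary4p3: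
  fixes m :: "'a metric" and D :: "real set" and u :: "real \<Rightarrow> 'a"
  assumes "mcomplete_of m"
    and "relatively_dense_in {0..} D"
    and "u \<in> mspace (BC_half_line m)"
  shows "asymptotically_almost_periodic m u \<longleftrightarrow>
         relatively_compact_in (BC_half_line m) ((\<lambda>\<tau>. translate_half_line \<tau> u) ` D)"
proof -
  interpret BC: Metric_space "mspace (BC_half_line m)" "mdist (BC_half_line m)" by simp
  note u = assms(3)
  have D: "(\<lambda>\<tau>. translate_half_line \<tau> u) ` D \<subseteq> (\<lambda>\<tau>. translate_half_line \<tau> u) ` {0..}"
    using assms(2) by (auto simp: relatively_dense_in_def)
  have "asymptotically_almost_periodic m u \<longleftrightarrow> translates_near_bounded_shifts m u"
    using asymptotically_almost_periodic_imp_near_bounded_shifts[OF u]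
      near_bounded_shifts_imp_asymptotically_almost_periodic[OF assms(1) u] by blast
  also have "\<dots> \<longleftrightarrow> BC.mtotally_bounded ((\<lambda>\<tau>. translate_half_line \<tau> u) ` D)"
    using BC.mtotally_bounded_subset[OF near_bounded_shifts_imp_mtotally_bounded[OF u] D]
      mtotally_bounded_imp_near_bounded_shifts[OF u assms(2)] by blast
  also have "\<dots> \<longleftrightarrow> relatively_compact_in (BC_half_line m) ((\<lambda>\<tau>. translate_half_line \<tau> u) ` D)"
    by (simp add: relatively_compact_in_iff_mtotally_bounded mcomplete_BC_half_line assms(1))
  finally show ?thesis .
qed

end
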